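(* Let $(L,[p])$ be a finite-dimensional restricted Leibniz algebra over a perfect field $\mathbb{F}$ of prime characteristic $p$. Then the following statements are equivalent: (1) Every element of $L$ is semisimple. (2) $[p]$ has no nontrivial zero. (3) $[p]$ is nonsingular.
   Context: A (left) Leibniz algebra over $\mathbb{F}$ is an $\mathbb{F}$-vector space $L$ with a bilinear bracket satisfying $[[x,y],z]=[x,[y,z]]-[y,[x,z]]$ for all $x,y,z\in L$; $L_a(x)=[a,x]$ denotes left multiplication. A restricted Leibniz algebra $(L,[p])$ is a Leibniz algebra $L$ with a $p$-mapping $[p]:L\to L$, $a\mapsto a^{[p]}$, i.e. a mapping such that for all $a,b\in L$, $\alpha\in\mathbb{F}$: (i) $L_{a^{[p]}}=(L_a)^p$; (ii) $(\alpha a)^{[p]}=\alpha^pa^{[p]}$; (iii) $(a+b)^{[p]}=a^{[p]}+b^{[p]}+\sum_{i=1}^{p-1}s_i(a,b)$, where $(L(a\otimes X+b\otimes1))^{p-1}(a\otimes 1)=\sum_{i=1}^{p-1}i\,s_i(a,b)\otimes X^{i-1}$ in $L\otimes_{\mathbb{F}}\mathbb{F}[X]$ (with bracket $[a\otimes f,b\otimes g]=[a,b]\otimes fg$, and $L(u)$ denoting left multiplication by $u$). $x^{[p]^i}$ denotes the image of $x$ under the $i$-th iterate of $[p]$. An element $x\in L$ is semisimple if $x=\sum_{i=1}^m\alpha_i x^{[p]^i}$ for some $m\ge 1$ and $\alpha_1,\dots,\alpha_m\in\mathbb{F}$. A zero of $[p]$ is an $x\in L$ with $x^{[p]}=0$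 (nontrivial if $x\neq0$). $[p]$ is nonsingular if $x^{[p]}\neq 0$ for every $0\ne x\in L$. *)

theory Defs
  imports "HOL-Computational_Algebra.Computational_Algebra"
begin

locale leibniz_algebra = vector_space scale
  for scale :: "'f::field \<Rightarrow> 'v::ab_group_add \<Rightarrow> 'v" +
  fixes br :: "'v \<Rightarrow> 'v \<Rightarrow> 'v"
  assumes linear_right: "Vector_Spaces.linear scale scale (br x)"
    and linear_left: "Vector_Spaces.linear scale scale (\<lambda>x. br x y)"
    and leibniz: "br (br x y) z = br x (br y z) - br y (br x z)"

text \<open>The tensor product of L with the polynomial ring in X is represented by the type
  of polynomials with coefficients in L; \<open>monom a n\<close> is the pure tensor of a with the
  n-th power of X. The bracket below is the bi-additive one with
  \<open>monom a i, monom b j \<mapsto> monom (br a b) (i + j)\<close>; see the lemmas that follow.\<close>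

definition poly_bracket ::
    "('v::ab_group_add \<Rightarrow> 'v \<Rightarrow> 'v) \<Rightarrow> 'v poly \<Rightarrow> 'v poly \<Rightarrow> 'v poly" where
  "poly_bracket br u v =
     (\<Sum>i\<le>degree u. \<Sum>j\<le>degree v. monom (br (coeff u i) (coeff v j)) (i + j))"

context leibniz_algebra
begin

lemma br_zero: "br 0 y = 0" "br x 0 = 0"
  using module_hom.zero[OF Vector_Spaces.linear.axioms(3)[OF linear_left]]
    module_hom.zero[OF Vector_Spaces.linear.axioms(3)[OF linear_right]] by auto

lemma br_add: "br (x + x') y = br x y + br x' y" "br x (y + y') = br x y + br x y'"
  using module_hom.add[OF Vector_Spaces.linear.axioms(3)[OF linear_left]]
    module_hom.add[OF Vector_Spaces.linear.axioms(3)[OF linear_right]] by auto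

lemma coeff_poly_bracket:
  "coeff (poly_bracket br u v) n = (\<Sum>i\<le>n. br (coeff u i) (coeff v (n - i)))"
proof -
  have inner: "(\<Sum>j\<le>degree v. if i + j = n then br (coeff u i) (coeff v j) else 0)
      = (if i \<le> n then br (coeff u i) (coeff v (n - i)) else 0)" for i
  proof (cases "i \<le> n")
    case True
    then have "(\<Sum>j\<le>degree v. if i + j = n then br (coeff u i) (coeff v j) else 0)
        = (\<Sum>j\<le>degree v. if j = n - i then br (coeff u i) (coeff v j) else 0)"
      by (intro sum.cong) auto
    also have "\<dots> = br (coeff u i) (coeff v (n - i))"
      by (auto simp: sum.delta coeff_eq_0 br_zero)
    finally show ?thesis using True by simp
  qed (auto intro!: sum.neutral)
  have "coeff (poly_bracket br u v) n
      = (\<Sum>i\<le>degree u. if i \<le> n then br (coeff u i) (coeff v (n - i)) else 0)"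
    by (simp add: poly_bracket_def coeff_sum inner cong: if_cong)
  also have "\<dots> = (\<Sum>i\<in>{..degree u} \<inter> {..n}. br (coeff u i) (coeff v (n - i)))"
    by (subst sum.inter_restrict) auto
  also have "\<dots> = (\<Sum>i\<le>n. br (coeff u i) (coeff v (n - i)))"
    by (rule sum.mono_neutral_left) (auto simp: br_zero intro!: le_degree)
  finally show ?thesis .
qed

lemma poly_bracket_add:
  "poly_bracket br (u + u') v = poly_bracket br u v + poly_bracket br u' v"
  "poly_bracket br u (v + v') = poly_bracket br u v + poly_bracket br u v'"
  by (auto simp: poly_eq_iff coeff_poly_bracket br_add sum.distrib)

lemma poly_bracket_monom:
  "poly_bracket br (monom a i) (monom b j) = monom (br a b) (i + j)"
proof (rule poly_eqI)
  fix n
  have "(\<Sum>k\<le>n. br (coeff (monom a i) k) (coeff (monom b j) (n - k)))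
      = (\<Sum>k\<le>n. if k = i then br a (coeff (monom b j) (n - k)) else 0)"
    by (intro sum.cong) (auto simp: br_zero)
  also have "\<dots> = coeff (monom (br a b) (i + j)) n"
    by (auto simp: sum.delta br_zero)
  finally show "coeff (poly_bracket br (monom a i) (monom b j)) n
      = coeff (monom (br a b) (i + j)) n"
    by (simp add: coeff_poly_bracket)
qed

end

text \<open>\<open>is_s_family scale br p a b s\<close>: the elements \<open>s 1, \<dots>, s (p - 1)\<close> are the
  \<open>s\<^sub>i(a,b)\<close> of the definition of a p-mapping. In characteristic p they are determined by this
  equation, because \<open>1, \<dots>, p - 1\<close> are invertible.\<close>

definition is_s_family ::
    "('f::field \<Rightarrow> 'v::ab_group_add \<Rightarrow> 'v) \<Rightarrow> ('v \<Rightarrow> 'v \<Rightarrow> 'v) \<Rightarrow> nat \<Rightarrow> 'v \<Rightarrow> 'v \<Rightarrow>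
      (nat \<Rightarrow> 'v) \<Rightarrow> bool" where
  "is_s_family scale br p a b s \<longleftrightarrow>
     (poly_bracket br (monom a 1 + monom b 0) ^^ (p - 1)) (monom a 0)
       = (\<Sum>i = 1..p - 1. monom (scale (of_nat i) (s i)) (i - 1))"

locale restricted_leibniz_algebra = leibniz_algebra scale br
  for scale :: "'f::field \<Rightarrow> 'v::ab_group_add \<Rightarrow> 'v"
    and br :: "'v \<Rightarrow> 'v \<Rightarrow> 'v" +
  fixes p :: nat and pmap :: "'v \<Rightarrow> 'v"
  assumes prime_p: "prime p"
    and char_p: "CHAR('f) = p"
    and br_pmap: "br (pmap a) = br a ^^ p"
    and pmap_scale: "pmap (scale \<alpha> a) = scale (\<alpha> ^ p) (pmap a)"
    and pmap_add: "\<exists>s. is_s_family scale br p a b s \<and>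
          pmap (a + b) = pmap a + pmap b + (\<Sum>i = 1..p - 1. s i)"

definition semisimple_element ::
    "('f::field \<Rightarrow> 'v::ab_group_add \<Rightarrow> 'v) \<Rightarrow> ('v \<Rightarrow> 'v) \<Rightarrow> 'v \<Rightarrow> bool" where
  "semisimple_element scale pmap x \<longleftrightarrow>
     (\<exists>m\<ge>1. \<exists>\<alpha> :: nat \<Rightarrow> 'f. x = (\<Sum>i = 1..m. scale (\<alpha> i) ((pmap ^^ i) x)))"

definition pmap_zero :: "('v::zero \<Rightarrow> 'v) \<Rightarrow> 'v \<Rightarrow> bool" where
  "pmap_zero pmap x \<longleftrightarrow> pmap x = 0"

definition nonsingular_pmap :: "('v::zero \<Rightarrow> 'v) \<Rightarrow> bool" where
  "nonsingular_pmap pmap \<longleftrightarrow> (\<forall>x. x \<noteq> 0 \<longrightarrow> pmap x \<noteq> 0)"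

text \<open>A field of characteristic p is perfect if every element is a p-th power; every field
  of characteristic 0 is perfect.\<close>

definition perfect_field :: "'f::field itself \<Rightarrow> bool" where
  "perfect_field _ \<longleftrightarrow> CHAR('f) = 0 \<or> surj (\<lambda>x::'f. x ^ CHAR('f))"

end

theory Submission
  imports Defs
begin

text \<open>
  If every element is semisimple then a zero \<open>x\<close> of the \<open>p\<close>-mapping is a combination of its
  iterates, all of which vanish, so \<open>x = 0\<close>. The content is the converse. If the \<open>p\<close>-mapping
  were additive, hence \<open>p\<close>-semilinear, on the span of the iterates of \<open>x\<close>, the converse would be
  linear algebra: some iterate is a combination of later ones, and since coefficients have
  \<open>p\<close>-th roots and the kernel is trivial, one application of the mapping after another can be
  cancelled from this relation (\<open>orbit_relation_descends\<close>).

  In a Leibniz algebra \<open>[x,x]\<close> need not vanish, so additivity on this span is not automatic. The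
  obstruction lives in the left kernel \<open>K = {z. L\<^sub>z = 0}\<close>. To remove it, the linear algebra above is
  carried out modulo a subspace \<open>Z\<close> and applied three times.

  On \<open>K\<close>, with \<open>Z = 0\<close>: the mapping is semilinear there and has trivial kernel, so it is onto \<open>K\<close>. As it also satisfies
  \<open>(a + z)\<^sup>[\<^sup>p\<^sup>] = a\<^sup>[\<^sup>p\<^sup>] + z\<^sup>[\<^sup>p\<^sup>]\<close> for \<open>z\<close> in \<open>K\<close>, an element whose image lies in \<open>K\<close> can be corrected
  by an element of \<open>K\<close> to a zero; hence it lies in \<open>K\<close> itself (\<open>left_kernel_if_pmap\<close>).

  On the span of the iterates of \<open>x\<close>, with \<open>Z = K\<close>: left multiplications by iterates of \<open>x\<close> are powers
  of \<open>L\<^sub>x\<close> and commute, so the mapping is additive modulo \<open>K\<close>. It follows that \<open>L\<^sub>x\<close> is a combination of the powers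
  \<open>L\<^sub>x\<^sup>q\<close> with \<open>q = p, p\<^sup>2, \<dots>\<close>. A vector killed by \<open>L\<^sub>x\<^sup>p\<close> is therefore killed by \<open>L\<^sub>x\<close>
  (\<open>br_eq_0_if_funpow_eq_0\<close>). The defining identity of the \<open>s\<^sub>i\<close> forces \<open>L\<^sub>x\<^sup>p\<^sup>-\<^sup>1\<close> to vanish on \<open>K\<close>,
  so \<open>L\<^sub>x\<close> vanishes on \<open>K\<close>, and then on every iterate of \<open>x\<close>.

  Finally, with \<open>Z = 0\<close> on the same span: brackets vanish there, so the mapping is additive and
  \<open>x\<close> is semisimple.
\<close>

section \<open>Semilinear maps modulo a subspace\<close>

definition orbit_from :: "('v \<Rightarrow> 'v) \<Rightarrow> 'v \<Rightarrow> nat \<Rightarrow> 'v set" where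
  "orbit_from f x k = (\<lambda>i. (f ^^ i) x) ` {k..}"

lemma orbit_from_antimono: "k \<le> l \<Longrightarrow> orbit_from f x l \<subseteq> orbit_from f x k"
  by (auto simp: orbit_from_def)

text \<open>The spans of the tails of an orbit decrease, so a tail whose span has least dimension has
  the same span as the next tail.\<close>

lemma (in finite_dimensional_vector_space) orbit_span_stabilises:
  "\<exists>k. (f ^^ k) x \<in> span (orbit_from f x (Suc k))"
proof -
  define d where "d k = dim (span (orbit_from f x k))" for k
  define k where "k = (ARG_MIN d k. True)"
  have "d k \<le> d (Suc k)"
    unfolding k_def by (rule arg_min_nat_le) simp
  moreover have "span (orbit_from f x (Suc k)) \<subseteq> span (orbit_from f x k)"
    by (intro span_mono orbit_from_antimono) simp
  ultimately have "span (orbit_from f x (Suc k)) = span (orbit_from f x k)"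
    unfolding d_def by (intro subspace_dim_equal subspace_span)
  moreover have "(f ^^ k) x \<in> span (orbit_from f x k)"
    by (intro span_base) (auto simp: orbit_from_def)
  ultimately show ?thesis by auto
qed

text \<open>The predicate of being an image modulo \<open>Z\<close> is inherited by linear combinations: sums by
  additivity modulo \<open>Z\<close>, multiples because every scalar is a \<open>p\<close>-th power.\<close>

lemma (in vector_space) orbit_span_preimage:
  fixes p :: nat
  assumes Z: "subspace Z" and p: "p > 0"
    and root: "surj (\<lambda>c::'a. c ^ p)"
    and scale: "\<And>c a. f (scale c a) = scale (c ^ p) (f a)"
    and add: "\<And>a b. \<lbrakk>a \<in> span (orbit_from f x 0); b \<in> span (orbit_from f x 0)\<rbrakk>
                \<Longrightarrow> f (a + b) - (f a + f b) \<in> Z"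
    and u: "u \<in> span (orbit_from f x (Suc k))"
  shows "\<exists>w\<in>span (orbit_from f x k). f w - u \<in> Z"
proof -
  have sub: "w \<in> span (orbit_from f x 0)" if "w \<in> span (orbit_from f x k)" for w
    using span_mono[OF orbit_from_antimono[of 0 k f x]] that by auto
  show ?thesis
    using u
  proof (induction rule: span_induct_alt)
    case base
    have "f 0 = 0"
      using scale[of 0 0] p by (simp add: zero_power)
    then show ?case
      using subspace_0[OF Z] by (intro bexI[of _ 0]) (auto simp: span_zero)
  next
    case (step c v u)
    from step.hyps obtain i where i: "i \<ge> Suc k" "v = (f ^^ i) x"
      by (auto simp: orbit_from_def)
    from step obtain w where w: "w \<in> span (orbit_from f x k)" "f w - u \<in> Z"
      by auto
    obtain d where d: "d ^ p = c"
      using root by (metis surjD)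
    define y where "y = (f ^^ (i - 1)) x"
    have y: "y \<in> span (orbit_from f x k)"
      unfolding y_def using i by (intro span_base) (auto simp: orbit_from_def)
    have fy: "f y = v"
      using i by (cases i) (auto simp: y_def)
    have dy: "scale d y \<in> span (orbit_from f x k)"
      using y by (rule span_scale)
    have "f (scale d y + w) - (f (scale d y) + f w) \<in> Z"
      by (intro add sub dy w)
    from subspace_add[OF Z this w(2)] have "f (scale d y + w) - (scale c v + u) \<in> Z"
      by (simp add: scale d fy algebra_simps)
    then show ?case
      using span_add[OF dy w(1)] by blast
  qed
qed

text \<open>One application of \<open>f\<close> is cancelled from \<open>f\<^sup>k\<^sup>+\<^sup>1 x \<in> \<langle>f\<^sup>i x. i > k + 1\<rangle> + Z\<close> by taking a preimage
  of the right-hand side.\<close>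

lemma (in finite_dimensional_vector_space) orbit_relation_descends:
  fixes p :: nat
  assumes Z: "subspace Z" and p: "p > 0"
    and root: "surj (\<lambda>c::'a. c ^ p)"
    and scale: "\<And>c a. f (scale c a) = scale (c ^ p) (f a)"
    and add: "\<And>a b. \<lbrakk>a \<in> span (orbit_from f x 0); b \<in> span (orbit_from f x 0)\<rbrakk>
                \<Longrightarrow> f (a + b) - (f a + f b) \<in> Z"
    and ker: "\<And>a. f a \<in> Z \<Longrightarrow> a \<in> Z"
  shows "\<exists>u\<in>span (orbit_from f x 1). x - u \<in> Z"
proof -
  have descend: "(\<exists>u\<in>span (orbit_from f x (Suc k)). (f ^^ k) x - u \<in> Z) \<Longrightarrow>
      \<exists>u\<in>span (orbit_from f x 1). x - u \<in> Z" for k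
  proof (induction k)
    case 0
    then show ?case by simp
  next
    case (Suc k)
    then obtain u where u: "u \<in> span (orbit_from f x (Suc (Suc k)))"
      "(f ^^ Suc k) x - u \<in> Z" by blast
    from orbit_span_preimage[OF Z p root scale add u(1)]
    obtain w where w: "w \<in> span (orbit_from f x (Suc k))" "f w - u \<in> Z" by blast
    define a where "a = (f ^^ k) x - w"
    have "w \<in> span (orbit_from f x 0)"
      using w(1) span_mono[OF orbit_from_antimono[of 0 "Suc k" f x]] by auto
    moreover from this have "a \<in> span (orbit_from f x 0)"
      unfolding a_def by (intro span_diff[OF span_base]) (auto simp: orbit_from_def)
    ultimately have "f (a + w) - (f a + f w) \<in> Z"
      by (intro add)
    then have "(f ^^ Suc k) x - (f a + f w) \<in> Z"
      by (simp add: a_def)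
    from subspace_diff[OF Z u(2) subspace_add[OF Z this w(2)]] have "f a \<in> Z"
      by (simp add: algebra_simps)
    then show ?case
      using Suc.IH ker[of a] w(1) unfolding a_def by blast
  qed
  obtain k where "(f ^^ k) x \<in> span (orbit_from f x (Suc k))"
    using orbit_span_stabilises by blast
  then show ?thesis
    using subspace_0[OF Z] by (intro descend[of k]) (auto intro!: bexI[of _ "(f ^^ k) x"])
qed

lemma (in vector_space) span_orbit_explicit:
  assumes "u \<in> span (orbit_from f x 1)"
  shows "\<exists>m\<ge>1. \<exists>\<alpha>. u = (\<Sum>i = 1..m. scale (\<alpha> i) ((f ^^ i) x))"
  using assms
proof (induction rule: span_induct_alt)
  case base
  show ?case
    by (intro exI[of _ "1::nat"] exI[of _ "\<lambda>_. 0"] conjI) simp_all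
next
  case (step c v u)
  from step.hyps obtain j where j: "j \<ge> 1" "v = (f ^^ j) x"
    by (auto simp: orbit_from_def)
  from step obtain m \<alpha> where m: "m \<ge> 1" "u = (\<Sum>i = 1..m. scale (\<alpha> i) ((f ^^ i) x))"
    by blast
  define M where "M = max m j"
  define \<beta> where "\<beta> i = (if i = j then c else 0) + (if i \<le> m then \<alpha> i else 0)" for i
  have "(\<Sum>i = 1..M. scale (\<beta> i) ((f ^^ i) x)) =
      (\<Sum>i = 1..M. if i = j then scale c ((f ^^ i) x) else 0) +
      (\<Sum>i = 1..M. if i \<le> m then scale (\<alpha> i) ((f ^^ i) x) else 0)"
    unfolding sum.distrib[symmetric]
    by (intro sum.cong) (auto simp: \<beta>_def scale_left_distrib)
  also have "(\<Sum>i = 1..M. if i = j then scale c ((f ^^ i) x) else 0) = scale c v"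
    using j by (simp add: M_def)
  also have "(\<Sum>i = 1..M. if i \<le> m then scale (\<alpha> i) ((f ^^ i) x) else 0) = u"
    unfolding m(2) by (intro sum.mono_neutral_cong_right) (auto simp: M_def)
  finally show ?case
    using m(1) by (intro exI[of _ M] exI[of _ \<beta>] conjI) (auto simp: M_def)
qed

section \<open>The left kernel of a restricted Leibniz algebra\<close>

context leibniz_algebra
begin

definition left_kernel :: "'v set" where
  "left_kernel = {z. \<forall>y. br z y = 0}"

lemma left_kernelD: "z \<in> left_kernel \<Longrightarrow> br z y = 0"
  by (simp add: left_kernel_def)

lemma br_scale: "br (scale c x) y = scale c (br x y)" "br x (scale c y) = scale c (br x y)"
  using module_hom.scale[OF Vector_Spaces.linear.axioms(3)[OF linear_left]]
    module_hom.scale[OF Vector_Spaces.linear.axioms(3)[OF linear_right]] by auto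

lemma subspace_left_kernel: "subspace left_kernel"
  by (auto simp: subspace_def left_kernel_def br_zero br_add br_scale)

lemma br_left_kernel:
  assumes "z \<in> left_kernel"
  shows "br a z \<in> left_kernel"
  using assms by (auto simp: left_kernel_def leibniz br_zero)

lemma funpow_br_zero: "(br a ^^ n) 0 = 0"
  by (induction n) (simp_all add: br_zero)

lemma funpow_br_eq_0_mono: "(br a ^^ m) v = 0 \<Longrightarrow> m \<le> n \<Longrightarrow> (br a ^^ n) v = 0"
  by (metis funpow_br_zero funpow_add comp_apply le_add_diff_inverse2)

lemma br_span_eq_0:
  assumes "a \<in> span A" "b \<in> span B" and AB: "\<And>a b. a \<in> A \<Longrightarrow> b \<in> B \<Longrightarrow> br a b = 0"
  shows "br a b = 0"
proof -
  have "br a' b = 0" if "a' \<in> A" for a'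
    using assms(2) by (induction rule: span_induct_alt) (auto simp: br_zero br_add br_scale AB that)
  with assms(1) show ?thesis
    by (induction rule: span_induct_alt) (auto simp: br_zero br_add br_scale)
qed

lemma br_eq_0_span:
  assumes "a \<in> span A" and "\<And>a. a \<in> A \<Longrightarrow> br a b = 0"
  shows "br a b = 0"
  using assms by (intro br_span_eq_0[of a A b "{b}"]) (auto intro: span_base)

lemma br_span_in_left_kernel:
  assumes a: "a \<in> span A" and b: "b \<in> span A"
    and comm: "\<And>a b v. a \<in> A \<Longrightarrow> b \<in> A \<Longrightarrow> br a (br b v) = br b (br a v)"
  shows "br a b \<in> left_kernel"
proof -
  have 1: "br a' (br b v) = br b (br a' v)" if "a' \<in> A" for a' v
    using b by (induction rule: span_induct_alt)
      (auto simp: br_zero br_add br_scale comm that)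
  have "br a (br b v) = br b (br a v)" for v
    using a by (induction rule: span_induct_alt) (auto simp: br_zero br_add br_scale 1)
  then show ?thesis
    by (simp add: left_kernel_def leibniz)
qed

end

context restricted_leibniz_algebra
begin

lemma p_ge_2: "p \<ge> 2"
  using prime_p by (rule prime_ge_2_nat)

lemma pmap_0: "pmap 0 = 0"
  using pmap_scale[of 0 0] p_ge_2 by (simp add: zero_power)

lemma of_nat_neq_0: "i \<in> {1..p - 1} \<Longrightarrow> (of_nat i :: 'f) \<noteq> 0"
  using char_p by (auto simp: of_nat_eq_0_iff_char_dvd dest: dvd_imp_le)

lemma funpow_pmap_0: "(pmap ^^ i) 0 = 0"
  by (induction i) (simp_all add: pmap_0)

lemma br_funpow_pmap: "br ((pmap ^^ i) x) = br x ^^ (p ^ i)"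
  by (induction i) (simp_all add: br_pmap funpow_mult mult.commute)

lemma left_kernel_pmap:
  assumes "z \<in> left_kernel"
  shows "pmap z \<in> left_kernel"
proof -
  obtain n where n: "p = Suc n"
    using p_ge_2 by (cases p) auto
  have "(br z ^^ p) y = 0" for y
    using assms by (simp add: n left_kernel_def)
  then show ?thesis
    by (simp add: left_kernel_def br_pmap)
qed

lemma coeff_s_family:
  assumes "is_s_family scale br p a b s"
  shows "coeff ((poly_bracket br (monom a 1 + monom b 0) ^^ (p - 1)) (monom a 0)) n
    = (if Suc n \<le> p - 1 then scale (of_nat (Suc n)) (s (Suc n)) else 0)"
proof -
  have "coeff ((poly_bracket br (monom a 1 + monom b 0) ^^ (p - 1)) (monom a 0)) n
    = (\<Sum>i = 1..p - 1. if i - 1 = n then scale (of_nat i) (s i) else 0)"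
    using assms by (simp add: is_s_family_def coeff_sum)
  also have "\<dots> = (\<Sum>i = 1..p - 1. if i = Suc n then scale (of_nat i) (s i) else 0)"
    by (intro sum.cong) auto
  finally show ?thesis
    by auto
qed

lemma coeff_poly_bracket_linear:
  "coeff (poly_bracket br (monom a 1 + monom b 0) v) n
    = (if n = 0 then 0 else br a (coeff v (n - 1))) + br b (coeff v n)"
proof -
  have "coeff (poly_bracket br (monom a 1) v) n = (if n = 0 then 0 else br a (coeff v (n - 1)))"
  proof -
    have "coeff (poly_bracket br (monom a 1) v) n
      = (\<Sum>i\<le>n. if i = 1 then br a (coeff v (n - i)) else 0)"
      unfolding coeff_poly_bracket by (intro sum.cong) (auto simp: br_zero)
    then show ?thesis by (auto simp: sum.delta)
  qed
  moreover have "coeff (poly_bracket br (monom b 0) v) n = br b (coeff v n)"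
  proof -
    have "coeff (poly_bracket br (monom b 0) v) n
      = (\<Sum>i\<le>n. if i = 0 then br b (coeff v (n - i)) else 0)"
      unfolding coeff_poly_bracket by (intro sum.cong) (auto simp: br_zero)
    then show ?thesis by (simp add: sum.delta)
  qed
  ultimately show ?thesis
    by (simp add: poly_bracket_add)
qed

text \<open>Applying \<open>L(a \<otimes> X + b \<otimes> 1)\<close> once to \<open>a \<otimes> 1\<close> gives coefficients in \<open>Z\<close>, further applications
  keep them there, and \<open>p - 1 \<ge> 1\<close>. Since \<open>1, \<dots>, p - 1\<close> are invertible scalars, the
  \<open>s\<^sub>i(a,b)\<close> lie in \<open>Z\<close>.\<close>

lemma pmap_add_modulo:
  assumes Z: "subspace Z"
    and inv: "\<And>z. z \<in> Z \<Longrightarrow> br a z \<in> Z" "\<And>z. z \<in> Z \<Longrightarrow> br b z \<in> Z"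
    and start: "br a a \<in> Z" "br b a \<in> Z"
  shows "pmap (a + b) - (pmap a + pmap b) \<in> Z"
proof -
  obtain s where s: "is_s_family scale br p a b s"
    "pmap (a + b) = pmap a + pmap b + (\<Sum>i = 1..p - 1. s i)"
    using pmap_add by blast
  let ?L = "poly_bracket br (monom a 1 + monom b 0)"
  have iter: "coeff ((?L ^^ Suc k) (monom a 0)) n \<in> Z" for k n
  proof (induction k arbitrary: n)
    case 0
    show ?case
      using start subspace_0[OF Z] by (auto simp: coeff_poly_bracket_linear br_zero simp del: One_nat_def)
  next
    case (Suc k)
    have "coeff (?L ((?L ^^ Suc k) (monom a 0))) n \<in> Z"
      unfolding coeff_poly_bracket_linear
      by (intro subspace_add[OF Z]) (auto simp del: funpow.simps One_nat_def intro: inv Suc subspace_0[OF Z])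
    then show ?case by simp
  qed
  have "s i \<in> Z" if i: "i \<in> {1..p - 1}" for i
  proof -
    have "Suc (p - 2) = p - 1"
      using p_ge_2 by simp
    then have "scale (of_nat i) (s i) \<in> Z"
      using iter[of "p - 2" "i - 1"] coeff_s_family[OF s(1), of "i - 1"] i
      by (simp del: funpow.simps)
    then have "scale (inverse (of_nat i)) (scale (of_nat i) (s i)) \<in> Z"
      by (rule subspace_scale[OF Z])
    then show ?thesis
      using of_nat_neq_0[OF i] by simp
  qed
  then show ?thesis
    using subspace_sum[OF Z, of "{1..p - 1}" s] s(2) by simp
qed

text \<open>For \<open>z\<close> in the left kernel, \<open>(L(a \<otimes> X + z \<otimes> 1))\<^sup>p\<^sup>-\<^sup>1(a \<otimes> 1)\<close> is a monomial of degree \<open>p - 1\<close>,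
  whereas the defining identity of the \<open>s\<^sub>i\<close> allows degree at most \<open>p - 2\<close>.\<close>

lemma pmap_add_left_kernel:
  assumes z: "z \<in> left_kernel"
  shows "pmap (a + z) = pmap a + pmap z"
proof -
  obtain s where s: "is_s_family scale br p a z s"
    "pmap (a + z) = pmap a + pmap z + (\<Sum>i = 1..p - 1. s i)"
    using pmap_add by blast
  let ?L = "poly_bracket br (monom a 1 + monom z 0)"
  have iter: "coeff ((?L ^^ k) (monom a 0)) n = (if n = k then (br a ^^ k) a else 0)" for k n
    by (induction k arbitrary: n)
      (auto simp: coeff_poly_bracket_linear left_kernelD[OF z] br_zero
        simp del: One_nat_def)
  have "s i = 0" if i: "i \<in> {1..p - 1}" for i
  proof -
    have "scale (of_nat i) (s i) = 0"
      using coeff_s_family[OF s(1), of "i - 1"] iter[of "p - 1" "i - 1"] i by auto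
    then show ?thesis
      using of_nat_neq_0[OF i] by simp
  qed
  then show ?thesis
    using s(2) by simp
qed

text \<open>With the two summands exchanged, \<open>s\<^sub>1(z,a) = L\<^sub>a\<^sup>p\<^sup>-\<^sup>1(z)\<close> is the only possibly nonzero
  \<open>s\<^sub>i(z,a)\<close>. Since addition is commutative, comparison with the previous lemma shows that it
  vanishes.\<close>

lemma funpow_br_left_kernel_eq_0:
  assumes z: "z \<in> left_kernel"
  shows "(br a ^^ (p - 1)) z = 0"
proof -
  obtain s where s: "is_s_family scale br p z a s"
    "pmap (z + a) = pmap z + pmap a + (\<Sum>i = 1..p - 1. s i)"
    using pmap_add by blast
  let ?L = "poly_bracket br (monom z 1 + monom a 0)"
  have iter: "coeff ((?L ^^ k) (monom z 0)) n = (if n = 0 then (br a ^^ k) z else 0)" for k n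
    by (induction k arbitrary: n)
      (auto simp: coeff_poly_bracket_linear left_kernelD[OF z] br_zero
        simp del: One_nat_def)
  have "s i = (if i = 1 then (br a ^^ (p - 1)) z else 0)" if i: "i \<in> {1..p - 1}" for i
  proof -
    have "scale (of_nat i) (s i) = (if i = 1 then (br a ^^ (p - 1)) z else 0)"
      using coeff_s_family[OF s(1), of "i - 1"] iter[of "p - 1" "i - 1"] i by auto
    then show ?thesis
      using of_nat_neq_0[OF i] by (auto split: if_splits)
  qed
  then have "(\<Sum>i = 1..p - 1. s i) = (\<Sum>i = 1..p - 1. if i = 1 then (br a ^^ (p - 1)) z else 0)"
    by (intro sum.cong) auto
  also have "\<dots> = (br a ^^ (p - 1)) z"
    using p_ge_2 by (auto simp: Suc_le_eq)
  finally show ?thesis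
    using s(2) pmap_add_left_kernel[OF z, of a] by (simp add: add.commute)
qed

lemma br_commute_orbit:
  assumes "a \<in> orbit_from pmap x 0" "b \<in> orbit_from pmap x 0"
  shows "br a (br b v) = br b (br a v)"
proof -
  obtain i j where "a = (pmap ^^ i) x" "b = (pmap ^^ j) x"
    using assms by (auto simp: orbit_from_def)
  moreover have "(br x ^^ (p ^ i)) ((br x ^^ (p ^ j)) v) = (br x ^^ (p ^ j)) ((br x ^^ (p ^ i)) v)"
    by (metis add.commute comp_apply funpow_add)
  ultimately show ?thesis
    by (simp add: br_funpow_pmap)
qed

lemma pmap_eq_0_imp_eq_0_if_semisimple:
  assumes "semisimple_element scale pmap x" "pmap x = 0"
  shows "x = 0"
proof -
  have "(pmap ^^ i) x = 0" if "i \<ge> 1" for i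
    using that assms(2) by (cases i) (simp_all add: funpow_Suc_right funpow_pmap_0 del: funpow.simps)
  then have "(\<Sum>i = 1..m. scale (\<alpha> i) ((pmap ^^ i) x)) = 0" for m \<alpha>
    by (intro sum.neutral) auto
  with assms(1) show ?thesis
    by (auto simp: semisimple_element_def)
qed

end

section \<open>A mapping without nontrivial zeros\<close>

locale zero_free_restricted_leibniz_algebra =
  restricted_leibniz_algebra scale br p pmap + finite_dimensional_vector_space scale Basis
  for scale :: "'f::field \<Rightarrow> 'v::ab_group_add \<Rightarrow> 'v"
    and br :: "'v \<Rightarrow> 'v \<Rightarrow> 'v" and p :: nat and pmap :: "'v \<Rightarrow> 'v" and Basis :: "'v set" +
  assumes surj_power: "surj (\<lambda>c::'f. c ^ p)"
    and zero_free: "pmap x = 0 \<Longrightarrow> x = 0"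
begin

lemma pmap_orbit_relation_descends:
  assumes "subspace Z"
    and "\<And>a b. \<lbrakk>a \<in> span (orbit_from pmap x 0); b \<in> span (orbit_from pmap x 0)\<rbrakk>
           \<Longrightarrow> pmap (a + b) - (pmap a + pmap b) \<in> Z"
    and "\<And>a. pmap a \<in> Z \<Longrightarrow> a \<in> Z"
  shows "\<exists>u\<in>span (orbit_from pmap x 1). x - u \<in> Z"
  using assms p_ge_2 surj_power pmap_scale by (intro orbit_relation_descends) auto

text \<open>The descent argument writes \<open>z\<close> as a combination of its proper iterates, and such a
  combination has a preimage.\<close>

lemma left_kernel_subset_pmap_image:
  assumes z: "z \<in> left_kernel"
  obtains w where "w \<in> left_kernel" "pmap w = z"
proof -
  have "(pmap ^^ i) z \<in> left_kernel" for i
    by (induction i) (auto simp: z left_kernel_pmap)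
  then have sub: "span (orbit_from pmap z 0) \<subseteq> left_kernel"
    by (intro span_minimal subspace_left_kernel) (auto simp: orbit_from_def)
  have add: "pmap (a + b) - (pmap a + pmap b) \<in> {0}"
    if "a \<in> span (orbit_from pmap z 0)" "b \<in> span (orbit_from pmap z 0)" for a b
    using pmap_add_left_kernel[of b a] sub that by auto
  have "\<exists>u\<in>span (orbit_from pmap z 1). z - u \<in> {0}"
    using subspace_single_0 add zero_free by (intro pmap_orbit_relation_descends) auto
  then have "z \<in> span (orbit_from pmap z (Suc 0))"
    by auto
  moreover have "p > 0"
    using p_ge_2 by simp
  ultimately have "\<exists>w\<in>span (orbit_from pmap z 0). pmap w - z \<in> {0}"
    using subspace_single_0 add surj_power pmap_scale by (intro orbit_span_preimage) auto
  then show ?thesis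
    using that sub by auto
qed

text \<open>Subtracting from \<open>a\<close> an element of the left kernel with the same image gives a zero of the
  mapping.\<close>

lemma left_kernel_if_pmap:
  assumes "pmap a \<in> left_kernel"
  shows "a \<in> left_kernel"
proof -
  have "- pmap a \<in> left_kernel"
    using assms subspace_neg[OF subspace_left_kernel] by blast
  then obtain w where w: "w \<in> left_kernel" "pmap w = - pmap a"
    by (rule left_kernel_subset_pmap_image)
  have "a + w = 0"
    using pmap_add_left_kernel[OF w(1), of a] w(2) by (simp add: zero_free)
  then have "a = - w"
    by (simp add: eq_neg_iff_add_eq_0)
  then show ?thesis
    using w(1) subspace_neg[OF subspace_left_kernel] by blast
qed

lemma orbit_relation_modulo_left_kernel:
  obtains u where "u \<in> span (orbit_from pmap x 1)" "x - u \<in> left_kernel"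
proof -
  have "pmap (a + b) - (pmap a + pmap b) \<in> left_kernel"
    if "a \<in> span (orbit_from pmap x 0)" "b \<in> span (orbit_from pmap x 0)" for a b
    using that
    by (intro pmap_add_modulo subspace_left_kernel br_left_kernel
        br_span_in_left_kernel[of _ "orbit_from pmap x 0"] br_commute_orbit)
  then have "\<exists>u\<in>span (orbit_from pmap x 1). x - u \<in> left_kernel"
    using subspace_left_kernel left_kernel_if_pmap by (intro pmap_orbit_relation_descends) auto
  then show ?thesis
    using that by blast
qed

text \<open>By the preceding relation, \<open>L\<^sub>x\<close> is a combination of \<open>p\<^sup>i\<close>-th powers of itself with
  \<open>i \<ge> 1\<close>.\<close>

lemma br_eq_0_if_funpow_eq_0:
  assumes "(br x ^^ p) v = 0"
  shows "br x v = 0"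
proof -
  obtain u where u: "u \<in> span (orbit_from pmap x 1)" "x - u \<in> left_kernel"
    by (rule orbit_relation_modulo_left_kernel)
  have "br a v = 0" if a: "a \<in> orbit_from pmap x 1" for a
  proof -
    obtain i where i: "i \<ge> 1" "a = (pmap ^^ i) x"
      using a by (auto simp: orbit_from_def)
    have "p ^ 1 \<le> p ^ i"
      using i(1) p_ge_2 by (intro power_increasing) auto
    then show ?thesis
      using funpow_br_eq_0_mono[OF assms, of "p ^ i"] by (simp add: i(2) br_funpow_pmap)
  qed
  with u(1) have "br u v = 0"
    by (rule br_eq_0_span)
  moreover have "br x v = br (x - u) v + br u v"
    by (simp flip: br_add)
  ultimately show ?thesis
    using left_kernelD[OF u(2)] by simp
qed

lemma br_right_left_kernel_eq_0:
  assumes "z \<in> left_kernel"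
  shows "br x z = 0"
  using funpow_br_eq_0_mono[OF funpow_br_left_kernel_eq_0[OF assms]]
  by (intro br_eq_0_if_funpow_eq_0) simp

text \<open>The bracket of \<open>x\<close> with an iterate \<open>b\<close> of \<open>x\<close> lies in the left kernel, where \<open>L\<^sub>x\<close>
  vanishes; so \<open>L\<^sub>x\<^sup>2\<close> kills \<open>b\<close>, and with it \<open>L\<^sub>x\<close>. Left multiplication by any other iterate is a
  power of \<open>L\<^sub>x\<close>.\<close>

lemma br_orbit_eq_0:
  assumes "a \<in> orbit_from pmap x 0" "b \<in> orbit_from pmap x 0"
  shows "br a b = 0"
proof -
  obtain i where i: "a = (pmap ^^ i) x"
    using assms(1) by (auto simp: orbit_from_def)
  have "x \<in> orbit_from pmap x 0"
    unfolding orbit_from_def by (rule image_eqI[of _ _ 0]) simp_all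
  then have "br x b \<in> left_kernel"
    using assms(2)
    by (intro br_span_in_left_kernel[of _ "orbit_from pmap x 0"] br_commute_orbit span_base)
  then have "(br x ^^ 2) b = 0"
    by (simp add: numeral_2_eq_2 br_right_left_kernel_eq_0)
  then have "br x b = 0"
    using p_ge_2 by (intro br_eq_0_if_funpow_eq_0) (rule funpow_br_eq_0_mono)
  then have "(br x ^^ 1) b = 0"
    by simp
  then have "(br x ^^ (p ^ i)) b = 0"
    by (rule funpow_br_eq_0_mono) (use p_ge_2 in simp)
  then show ?thesis
    by (simp add: i br_funpow_pmap)
qed

lemma every_element_semisimple: "semisimple_element scale pmap x"
proof -
  have "pmap (a + b) - (pmap a + pmap b) \<in> {0}"
    if a: "a \<in> span (orbit_from pmap x 0)" and b: "b \<in> span (orbit_from pmap x 0)" for a b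
    using br_span_eq_0[OF a a br_orbit_eq_0] br_span_eq_0[OF b a br_orbit_eq_0] subspace_single_0
    by (intro pmap_add_modulo) (auto simp: br_zero)
  then have "\<exists>u\<in>span (orbit_from pmap x 1). x - u \<in> {0}"
    using subspace_single_0 zero_free by (intro pmap_orbit_relation_descends) auto
  then have "x \<in> span (orbit_from pmap x 1)"
    by auto
  then show ?thesis
    unfolding semisimple_element_def by (rule span_orbit_explicit)
qed

end

section \<open>The equivalence\<close>

theorem theorem4p5:
  fixes scale :: "'f::field \<Rightarrow> 'v::ab_group_add \<Rightarrow> 'v"
    and br :: "'v \<Rightarrow> 'v \<Rightarrow> 'v"
    and p :: nat
    and pmap :: "'v \<Rightarrow> 'v"
    and Basis :: "'v set"
  assumes "restricted_leibniz_algebra scale br p pmap"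
    and "finite_dimensional_vector_space scale Basis"
    and "perfect_field TYPE('f)"
  shows "((\<forall>x. semisimple_element scale pmap x) \<longleftrightarrow> \<not> (\<exists>x. x \<noteq> 0 \<and> pmap_zero pmap x))
    \<and> (\<not> (\<exists>x. x \<noteq> 0 \<and> pmap_zero pmap x) \<longleftrightarrow> nonsingular_pmap pmap)"
proof -
  interpret restricted_leibniz_algebra scale br p pmap by fact
  have "surj (\<lambda>c::'f. c ^ p)"
    using assms(3) char_p p_ge_2 by (auto simp: perfect_field_def)
  then have "semisimple_element scale pmap x" if "\<And>x. pmap x = 0 \<Longrightarrow> x = 0" for x
    using that assms(1,2)
    by (intro zero_free_restricted_leibniz_algebra.every_element_semisimple
        zero_free_restricted_leibniz_algebra.intro zero_free_restricted_leibniz_algebra_axioms.intro)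
  then show ?thesis
    using pmap_eq_0_imp_eq_0_if_semisimple
    unfolding pmap_zero_def nonsingular_pmap_def by blast
qed

end
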